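(* Let $K:SO(3)\times SO(3)\to\mathbb{R}$ be of the form $K(R,Q)=g(d(R,Q)^2)$ with $g:[0,\infty)\to\mathbb{R}$ differentiable with locally Lipschitz continuous derivative, and let $0<r<\pi/6$ be fixed. Let $N$ be a positive integer. Suppose that: (i) $g'(s)\geq c$ for all $s\in[0,4r^2]$, for some $c>0$; (ii) the initial points satisfy $R_i^0\in\overline{D}_r$ for $i=1,\dots,N$. Let $(R_i(t))_{i=1}^N$ be the global solution to $$\dot R_i=-\frac1N\sum_{j=1}^N\nabla K_{R_j}(R_i),\quad t>0,\qquad R_i(0)=R_i^0.$$ Then $\lim_{t\to\infty}d(R_i(t),R_j(t))=0$ exponentially fast for all $i,j\in\{1,\dots,N\}$.
   Context: $SO(3)$ is the group of $3\times3$ rotation matrices, with $T_RSO(3)=\{RA: A\in\mathbb{R}^{3\times3},\ A^T=-A\}$ and Riemannian metric $RA_1\cdot RA_2=\frac12\langle A_1,A_2\rangle_F$ ($\langle\cdot,\cdot\rangle_F$ is the Frobenius inner product). $d$ is the geodesic distance, $d(R,Q)=\arccos\big(\frac{\mathrm{tr}(R^TQ)-1}{2}\big)$, and $\nabla$ is the Riemannian gradient on $SO(3)$. $D_r=\{Q\in SO(3): d(I,Q)<r\}$ and $\overline{D}_r$ is its closure. $K_Q(R)=K(R,Q)$, and $\nabla K_Q(R)$ is the gradient in $R$; explicitly $\nabla K_Q(R)=-2g'(d(R,Q)^2)\log_RQ$ where $\log_RQ=R\log(R^TQ)$ is the Riemannian logarithm (for $d(R,Q)<\pi$). The global solution is the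 unique family of trajectories $R_i:[0,\infty)\to\overline{D}_r$ solving the system (its global well-posedness and the invariance of $\overline{D}_r$ are established elsewhere in the paper). "Exponentially fast" means that there are constants $A,\lambda>0$ with $d(R_i(t),R_j(t))\le A e^{-\lambda t}$ for all $t\ge0$. *)

theory Defs
  imports "HOL-Analysis.Analysis"
begin

definition SO3 :: "(real^3^3) set" where
  "SO3 = {R. rotation_matrix R}"

definition tangent_SO3 :: "real^3^3 \<Rightarrow> (real^3^3) set" where
  "tangent_SO3 R = {R ** A | A. transpose A = - A}"

(* The Riemannian metric (R A1) . (R A2) = (1/2) <A1, A2>_F; here A = R^T V recovers A from
   V = R A, and the inner product of the type real^3^3 is the Frobenius inner product. *)
definition metric_SO3 :: "real^3^3 \<Rightarrow> real^3^3 \<Rightarrow> real^3^3 \<Rightarrow> real" where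
  "metric_SO3 R V W = (1/2) * ((transpose R ** V) \<bullet> (transpose R ** W))"

definition dist_SO3 :: "real^3^3 \<Rightarrow> real^3^3 \<Rightarrow> real" where
  "dist_SO3 R Q = arccos ((trace (transpose R ** Q) - 1) / 2)"

definition disc_SO3 :: "real \<Rightarrow> (real^3^3) set" where
  "disc_SO3 r = {Q \<in> SO3. dist_SO3 (mat 1) Q < r}"

(* G is the Riemannian gradient at R of f restricted to SO(3).  A derivative D of f at R within
   SO(3) is determined only on the tangent space at R, where it is the differential of the
   restriction of f to SO(3); its values off the tangent space are arbitrary and are not used. *)
definition has_gradient_SO3 :: "(real^3^3 \<Rightarrow> real) \<Rightarrow> real^3^3 \<Rightarrow> real^3^3 \<Rightarrow> bool" where
  "has_gradient_SO3 f G R \<longleftrightarrow>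
     G \<in> tangent_SO3 R \<and>
     (\<exists>D. (f has_derivative D) (at R within SO3) \<and>
          (\<forall>V \<in> tangent_SO3 R. D V = metric_SO3 R G V))"

definition gradient_SO3 :: "(real^3^3 \<Rightarrow> real) \<Rightarrow> real^3^3 \<Rightarrow> real^3^3" where
  "gradient_SO3 f R = (THE G. has_gradient_SO3 f G R)"

(* A global solution, with agents indexed by 1..N, includes the requirement that the trajectories
   stay in the closed disc.  The closure is taken in the space of all 3x3 matrices, in which SO(3)
   is closed.  The equation is imposed for t > 0 only, so continuity on [0, infinity) is needed to
   tie the trajectory to its initial value. *)
definition global_solution ::
  "nat \<Rightarrow> real \<Rightarrow> (real^3^3 \<Rightarrow> real^3^3 \<Rightarrow> real) \<Rightarrow> (nat \<Rightarrow> real^3^3) \<Rightarrow> (nat \<Rightarrow> real \<Rightarrow> real^3^3) \<Rightarrow> bool"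
  where
  "global_solution N r K R0 R \<longleftrightarrow>
     (\<forall>i \<in> {1..N}.
        R i 0 = R0 i \<and>
        continuous_on {0..} (R i) \<and>
        (\<forall>t \<ge> 0. R i t \<in> closure (disc_SO3 r)) \<and>
        (\<forall>t > 0. (R i has_vector_derivative
            - ((1 / real N) *\<^sub>R (\<Sum>j = 1..N. gradient_SO3 (\<lambda>X. K X (R j t)) (R i t)))) (at t)))"

end

theory Submission
  imports Defs
begin

text \<open>
  Write \<open>X \<bullet> Y\<close> for the Frobenius inner product, so that on rotations
  \<open>X \<bullet> Y = 1 + 2 cos d(X, Y)\<close>.  The proof is a maximum principle for the largest pairwise
  distance, measured by \<open>3 - R\<^sub>i \<bullet> R\<^sub>j\<close>.

  The gradient of \<open>K\<close> is computed extrinsically in \<open>gradient_SO3_radial\<close>.  It turns the system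
  into
  \<open>R\<^sub>i' = (1/N) \<Sum>\<^sub>k a\<^sub>i\<^sub>k (R\<^sub>k - R\<^sub>i R\<^sub>k\<^sup>T R\<^sub>i)\<close> with \<open>a\<^sub>i\<^sub>k = g'(d\<^sup>2) d / sin d\<close> and \<open>d = d(R\<^sub>i, R\<^sub>k)\<close>.
  By the triangle inequality all distances are at most \<open>2r\<close>, hence below \<open>\<pi>/3\<close>, and therefore
  \<open>a\<^sub>i\<^sub>k \<ge> c\<close>.

  Suppose that \<open>(i, j)\<close> is a pair at maximal distance.  Then \<open>d(R\<^sub>k, R\<^sub>j) \<le> d(R\<^sub>i, R\<^sub>j)\<close> for every
  \<open>k\<close>, so the geodesics from \<open>R\<^sub>i\<close> to \<open>R\<^sub>k\<close> and to \<open>R\<^sub>j\<close> enclose an angle of at most \<open>\<pi>/2\<close>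
  (\<open>SO3_acute_angle\<close>): no agent \<open>k\<close> pulls \<open>R\<^sub>i\<close> away from \<open>R\<^sub>j\<close>, while the term \<open>k = j\<close> alone
  contracts at a rate proportional to \<open>3 - R\<^sub>i \<bullet> R\<^sub>j\<close> (\<open>attraction_lower_bound\<close>).  The spherical
  trigonometry behind both facts is done with unit quaternions: the relevant rotations lift to
  quaternions \<open>p, q\<close> with positive real part, and then \<open>P \<bullet> Q = 4 \<langle>p, q\<rangle>\<^sup>2 - 1\<close>.

  Consequently the derivative of \<open>3 - R\<^sub>i \<bullet> R\<^sub>j\<close> is at most \<open>-4c/N\<close> times its value whenever
  \<open>(i, j)\<close> is a maximal pair, and \<open>max_exp_decay\<close> bounds all these functions by \<open>4 exp (-4ct/N)\<close>.  Since
  \<open>d\<^sup>2 \<le> 4 (1 - cos d)\<close> for \<open>d \<le> \<pi>/3\<close>, the distances decay exponentially at rate \<open>2c/N\<close>.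
\<close>

section \<open>The Frobenius inner product and rotation matrices\<close>

lemma trace_transpose_mult: "trace (transpose X ** Y) = X \<bullet> (Y :: real^'n^'n)"
  unfolding trace_def matrix_matrix_mult_def transpose_def inner_vec_def
  by (simp, rule sum.swap)

lemma inner_transpose: "transpose X \<bullet> transpose Y = X \<bullet> (Y :: real^'n^'n)"
  unfolding transpose_def inner_vec_def by (simp, rule sum.swap)

lemma inner_mult_left:
  fixes A X Y :: "real^'n^'n"
  shows "(A ** X) \<bullet> Y = X \<bullet> (transpose A ** Y)"
  using trace_transpose_mult[of "A ** X" Y] trace_transpose_mult[of X "transpose A ** Y"]
  by (simp add: matrix_transpose_mul matrix_mul_assoc)

lemma mat_1_inner: "mat 1 \<bullet> (Q :: real^'n^'n) = trace Q"
  using trace_transpose_mult[of "mat 1" Q] by (simp add: transpose_mat)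

lemma matrix_mult_scaleR_right:
  fixes A :: "real^'n^'m"
  shows "A ** (k *\<^sub>R B) = k *\<^sub>R (A ** B)"
  by (simp add: matrix_scalar_ac scalar_matrix_assoc)

lemma matrix_mult_diff_right:
  fixes A :: "real^'n^'m"
  shows "A ** (B - C) = A ** B - A ** C"
  by (simp add: matrix_matrix_mult_def vec_eq_iff sum_subtractf algebra_simps)

lemma transpose_diff: "transpose (A - B) = transpose A - transpose (B :: real^'n^'m)"
  by (simp add: transpose_def vec_eq_iff)

lemma SO3_orthogonal:
  assumes "P \<in> SO3"
  shows "transpose P ** P = mat 1" "P ** transpose P = mat 1"
  using assms by (auto simp: SO3_def rotation_matrix_def orthogonal_matrix_def)

lemma SO3_transpose_mult: "P \<in> SO3 \<Longrightarrow> Q \<in> SO3 \<Longrightarrow> transpose P ** Q \<in> SO3"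
  by (auto simp: SO3_def rotation_matrix_def det_mul orthogonal_matrix_mul orthogonal_matrix_transpose)

lemma SO3_mult: "P \<in> SO3 \<Longrightarrow> Q \<in> SO3 \<Longrightarrow> P ** Q \<in> SO3"
  by (auto simp: SO3_def rotation_matrix_def det_mul orthogonal_matrix_mul)

lemma inner_mult_SO3:
  fixes X Y :: "real^3^3"
  assumes "R \<in> SO3"
  shows "(R ** X) \<bullet> (R ** Y) = X \<bullet> Y" "(transpose R ** X) \<bullet> (transpose R ** Y) = X \<bullet> Y"
  using SO3_orthogonal(1,2)[OF assms] by (simp_all add: inner_mult_left matrix_mul_assoc)

lemma dist_SO3_inner: "dist_SO3 X Y = arccos ((X \<bullet> Y - 1) / 2)"
  by (simp add: dist_SO3_def trace_transpose_mult)

text \<open>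
  A rotation matrix equals its cofactor matrix, because it preserves cross products.
\<close>

lemma rotation_matrix_cofactors:
  assumes "rotation_matrix (P :: real^3^3)"
  shows "P$1$1 = P$2$2 * P$3$3 - P$2$3 * P$3$2"
        "P$2$2 = P$3$3 * P$1$1 - P$3$1 * P$1$3"
        "P$3$3 = P$1$1 * P$2$2 - P$1$2 * P$2$1"
        "P$1$2 = P$2$3 * P$3$1 - P$2$1 * P$3$3"
        "P$2$1 = P$3$2 * P$1$3 - P$1$2 * P$3$3"
        "P$1$3 = P$2$1 * P$3$2 - P$2$2 * P$3$1"
        "P$3$1 = P$1$2 * P$2$3 - P$1$3 * P$2$2"
        "P$2$3 = P$1$2 * P$3$1 - P$1$1 * P$3$2"
        "P$3$2 = P$2$1 * P$1$3 - P$1$1 * P$2$3"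
proof -
  have c: "cross3 (P *v axis i 1) (P *v axis j 1) = P *v cross3 (axis i 1) (axis j 1)" for i j
    by (rule cross_rotation_matrix[OF assms])
  show "P$1$1 = P$2$2 * P$3$3 - P$2$3 * P$3$2"
        "P$2$2 = P$3$3 * P$1$1 - P$3$1 * P$1$3"
        "P$3$3 = P$1$1 * P$2$2 - P$1$2 * P$2$1"
        "P$1$2 = P$2$3 * P$3$1 - P$2$1 * P$3$3"
        "P$2$1 = P$3$2 * P$1$3 - P$1$2 * P$3$3"
        "P$1$3 = P$2$1 * P$3$2 - P$2$2 * P$3$1"
        "P$3$1 = P$1$2 * P$2$3 - P$1$3 * P$2$2"
        "P$2$3 = P$1$2 * P$3$1 - P$1$1 * P$3$2"
        "P$3$2 = P$2$1 * P$1$3 - P$1$1 * P$2$3"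
    using c[of 1 2] c[of 2 3] c[of 3 1]
    by (simp_all add: cross3_simps vec_eq_iff forall_3 matrix_vector_mult_def sum_3 axis_def)
qed

lemma orthonormal_entries:
  assumes "rotation_matrix (P :: real^3^3)"
  shows "(P$i$1)\<^sup>2 + (P$i$2)\<^sup>2 + (P$i$3)\<^sup>2 = 1"
        "(P$1$i)\<^sup>2 + (P$2$i)\<^sup>2 + (P$3$i)\<^sup>2 = 1"
        "i \<noteq> j \<Longrightarrow> P$i$1 * P$j$1 + P$i$2 * P$j$2 + P$i$3 * P$j$3 = 0"
        "i \<noteq> j \<Longrightarrow> P$1$i * P$1$j + P$2$i * P$2$j + P$3$i * P$3$j = 0"
proof -
  have "(transpose P ** P)$i$j = mat 1 $ i $ j" "(P ** transpose P)$i$j = mat 1 $ i $ j" for i j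
    using SO3_orthogonal[of P] assms by (simp_all add: SO3_def)
  then have *: "P$1$i * P$1$j + P$2$i * P$2$j + P$3$i * P$3$j = (if i = j then 1 else 0)"
    "P$i$1 * P$j$1 + P$i$2 * P$j$2 + P$i$3 * P$j$3 = (if i = j then 1 else 0)" for i j
    by (simp_all add: matrix_matrix_mult_def transpose_def sum_3 mat_def)
  show "(P$i$1)\<^sup>2 + (P$i$2)\<^sup>2 + (P$i$3)\<^sup>2 = 1" "(P$1$i)\<^sup>2 + (P$2$i)\<^sup>2 + (P$3$i)\<^sup>2 = 1"
        "i \<noteq> j \<Longrightarrow> P$i$1 * P$j$1 + P$i$2 * P$j$2 + P$i$3 * P$j$3 = 0"
        "i \<noteq> j \<Longrightarrow> P$1$i * P$1$j + P$2$i * P$2$j + P$3$i * P$3$j = 0"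
    using *[of i i] *[of i j] by (simp_all add: power2_eq_square)
qed

text \<open>
  The squares of the off-diagonal differences are \<open>(4wx)\<^sup>2\<close>, \<open>(4wy)\<^sup>2\<close> and \<open>(4wz)\<^sup>2\<close> if \<open>P\<close> is given by the
  unit quaternion \<open>w + xi + yj + zk\<close>; the two factors on the right are \<open>4w\<^sup>2\<close> and, for instance,
  \<open>4x\<^sup>2\<close>.
\<close>

lemma SO3_squared_differences:
  assumes "P \<in> SO3"
  shows "(P$3$2 - P$2$3) * (P$3$2 - P$2$3) = (1 + P$1$1 + P$2$2 + P$3$3) * (1 + P$1$1 - P$2$2 - P$3$3)"
    "(P$1$3 - P$3$1) * (P$1$3 - P$3$1) = (1 + P$1$1 + P$2$2 + P$3$3) * (1 - P$1$1 + P$2$2 - P$3$3)"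
    "(P$2$1 - P$1$2) * (P$2$1 - P$1$2) = (1 + P$1$1 + P$2$2 + P$3$3) * (1 - P$1$1 - P$2$2 + P$3$3)"
proof -
  have rot: "rotation_matrix P" using assms by (simp add: SO3_def)
  note cof = rotation_matrix_cofactors(1-3)[OF rot]
  note orth = orthonormal_entries(1,2)[OF rot]
  show "(P$3$2 - P$2$3) * (P$3$2 - P$2$3) = (1 + P$1$1 + P$2$2 + P$3$3) * (1 + P$1$1 - P$2$2 - P$3$3)"
    "(P$1$3 - P$3$1) * (P$1$3 - P$3$1) = (1 + P$1$1 + P$2$2 + P$3$3) * (1 - P$1$1 + P$2$2 - P$3$3)"
    "(P$2$1 - P$1$2) * (P$2$1 - P$1$2) = (1 + P$1$1 + P$2$2 + P$3$3) * (1 - P$1$1 - P$2$2 + P$3$3)"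
    using cof orth(1)[of 1] orth(1)[of 2] orth(1)[of 3] orth(2)[of 1] orth(2)[of 2] orth(2)[of 3]
    by - (simp (no_asm_use) only: algebra_simps power2_eq_square mult_1_left mult_1_right; linarith)+
qed

lemma SO3_trace_bounds:
  assumes "P \<in> SO3"
  shows "-1 \<le> trace P" "trace P \<le> 3"
proof -
  have "(1 + trace P) * (3 - trace P) =
      (P$3$2 - P$2$3) * (P$3$2 - P$2$3) + (P$1$3 - P$3$1) * (P$1$3 - P$3$1) + (P$2$1 - P$1$2) * (P$2$1 - P$1$2)"
    unfolding SO3_squared_differences[OF assms] by (simp add: trace_def sum_3 algebra_simps)
  then have "(1 + trace P) * (3 - trace P) \<ge> 0"
    by simp
  then show "-1 \<le> trace P" "trace P \<le> 3"
    by (auto simp: zero_le_mult_iff)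
qed

lemma SO3_inner_bounds:
  assumes "P \<in> SO3" "Q \<in> SO3"
  shows "-1 \<le> P \<bullet> Q" "P \<bullet> Q \<le> 3"
  using SO3_trace_bounds[OF SO3_transpose_mult[OF assms]] by (simp_all add: trace_transpose_mult)

lemma trace_gt_of_mem_disc:
  assumes "X \<in> disc_SO3 r" "r \<le> pi"
  shows "1 + 2 * cos r < trace X"
proof -
  have X: "X \<in> SO3" and d: "arccos ((trace X - 1) / 2) < r"
    using assms(1) by (simp_all add: disc_SO3_def dist_SO3_def)
  have b: "-1 \<le> (trace X - 1) / 2" "(trace X - 1) / 2 \<le> 1"
    using SO3_trace_bounds[OF X] by simp_all
  have "cos r < cos (arccos ((trace X - 1) / 2))"
    using d arccos_lbound[OF b] assms(2) by (intro cos_monotone_0_pi)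
  also have "\<dots> = (trace X - 1) / 2" using b by (rule cos_arccos)
  finally show ?thesis by simp
qed

lemma closure_disc_SO3:
  assumes "X \<in> closure (disc_SO3 r)" "r \<le> pi"
  shows "X \<in> SO3" "1 + 2 * cos r \<le> trace X"
proof -
  \<comment> \<open>The set \<open>T\<close> is a closed superset of the disc.\<close>
  define T where "T = {X :: real^3^3. (\<forall>i j. (\<Sum>k\<in>UNIV. X$k$i * X$k$j) = (mat 1 :: real^3^3)$i$j)
    \<and> det X = 1 \<and> 1 + 2 * cos r \<le> mat 1 \<bullet> X}"
  have T: "X \<in> T \<longleftrightarrow> X \<in> SO3 \<and> 1 + 2 * cos r \<le> trace X" for X
  proof -
    have "transpose X ** X = mat 1 \<longleftrightarrow> (\<forall>i j. (\<Sum>k\<in>UNIV. X$k$i * X$k$j) = (mat 1 :: real^3^3)$i$j)"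
      unfolding vec_eq_iff by (simp add: matrix_matrix_mult_def transpose_def)
    then show ?thesis
      by (simp add: T_def SO3_def rotation_matrix_def orthogonal_matrix mat_1_inner)
  qed
  \<comment> \<open>Both orthogonality and the determinant condition are polynomial equations in the entries.\<close>
  have "closed T"
    unfolding T_def det_3
    by (intro closed_Collect_conj closed_Collect_all closed_Collect_eq closed_Collect_le continuous_intros)
  moreover have "disc_SO3 r \<subseteq> T"
    using trace_gt_of_mem_disc[OF _ assms(2)] by (force simp: T disc_SO3_def)
  ultimately have "X \<in> T" using closure_minimal assms(1) by blast
  then show "X \<in> SO3" "1 + 2 * cos r \<le> trace X" by (simp_all add: T)
qed

section \<open>Unit quaternions\<close>

text \<open>
  The matrix of the map \<open>v \<mapsto> q v q\<^sup>*\<close> on imaginary quaternions, for \<open>q = w + xi + yj + zk\<close>.  It is a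
  rotation if \<open>q\<close> has norm 1.  The quaternion is kept as four real coordinates.
\<close>

definition quat_matrix :: "real \<Rightarrow> real \<Rightarrow> real \<Rightarrow> real \<Rightarrow> real^3^3" where
  "quat_matrix w x y z = vector [
     vector [w\<^sup>2 + x\<^sup>2 - y\<^sup>2 - z\<^sup>2, 2 * (x * y - w * z), 2 * (x * z + w * y)],
     vector [2 * (x * y + w * z), w\<^sup>2 - x\<^sup>2 + y\<^sup>2 - z\<^sup>2, 2 * (y * z - w * x)],
     vector [2 * (x * z - w * y), 2 * (y * z + w * x), w\<^sup>2 - x\<^sup>2 - y\<^sup>2 + z\<^sup>2]]"

lemma trace_quat_matrix:
  assumes "w\<^sup>2 + x\<^sup>2 + y\<^sup>2 + z\<^sup>2 = 1"
  shows "trace (quat_matrix w x y z) = 4 * w\<^sup>2 - 1"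
  using assms by (simp add: quat_matrix_def trace_def sum_3 algebra_simps)

lemma transpose_quat_matrix: "transpose (quat_matrix w x y z) = quat_matrix w (-x) (-y) (-z)"
  by (simp add: quat_matrix_def transpose_def vec_eq_iff forall_3 algebra_simps)

lemma inner_quat_matrix:
  assumes "w\<^sup>2 + x\<^sup>2 + y\<^sup>2 + z\<^sup>2 = 1" "w'\<^sup>2 + x'\<^sup>2 + y'\<^sup>2 + z'\<^sup>2 = 1"
  shows "quat_matrix w x y z \<bullet> quat_matrix w' x' y' z' = 4 * (w * w' + x * x' + y * y' + z * z')\<^sup>2 - 1"
proof -
  have "quat_matrix w x y z \<bullet> quat_matrix w' x' y' z' =
    4 * (w * w' + x * x' + y * y' + z * z')\<^sup>2 - (w\<^sup>2 + x\<^sup>2 + y\<^sup>2 + z\<^sup>2) * (w'\<^sup>2 + x'\<^sup>2 + y'\<^sup>2 + z'\<^sup>2)"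
    unfolding quat_matrix_def inner_vec_def sum_3
    by (simp add: algebra_simps power2_eq_square)
  then show ?thesis using assms by simp
qed

lemma quat_matrix_SO3:
  assumes "w\<^sup>2 + x\<^sup>2 + y\<^sup>2 + z\<^sup>2 = 1"
  shows "quat_matrix w x y z \<in> SO3"
proof -
  define n where "n = w\<^sup>2 + x\<^sup>2 + y\<^sup>2 + z\<^sup>2"
  have "transpose (quat_matrix w x y z) ** quat_matrix w x y z = n\<^sup>2 *\<^sub>R mat 1"
    by (simp add: quat_matrix_def transpose_def matrix_matrix_mult_def mat_def sum_3 vec_eq_iff forall_3
        n_def power2_eq_square algebra_simps)
  moreover have "det (quat_matrix w x y z) = n ^ 3"
    by (simp add: quat_matrix_def det_3 n_def power2_eq_square power3_eq_cube algebra_simps)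
  ultimately show ?thesis
    using assms by (simp add: SO3_def rotation_matrix_def orthogonal_matrix n_def)
qed

text \<open>
  Every rotation by an angle less than \<open>\<pi>\<close> comes from a unit quaternion with positive real part.  The
  quaternion is \<open>w = sqrt (1 + trace P) / 2\<close> together with the axial vector of \<open>P\<close> divided by \<open>4w\<close>.
\<close>

lemma SO3_quaternion:
  assumes P: "P \<in> SO3" and tr: "trace P > -1"
  obtains w x y z where "w > 0" "w\<^sup>2 + x\<^sup>2 + y\<^sup>2 + z\<^sup>2 = 1" "P = quat_matrix w x y z"
proof -
  have rot: "rotation_matrix P" using P by (simp add: SO3_def)
  note cof = rotation_matrix_cofactors[OF rot]
  note orth = orthonormal_entries[OF rot]
  define T where "T = 1 + P$1$1 + P$2$2 + P$3$3"
  have T: "T > 0" using tr by (simp add: T_def trace_def sum_3)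
  define w where "w = sqrt T / 2"
  define x where "x = (P$3$2 - P$2$3) / (4 * w)"
  define y where "y = (P$1$3 - P$3$1) / (4 * w)"
  define z where "z = (P$2$1 - P$1$2) / (4 * w)"
  have w: "w > 0" "4 * w\<^sup>2 = T" using T by (simp_all add: w_def power_divide)
  have wx: "4 * w * x = P$3$2 - P$2$3" "4 * w * y = P$1$3 - P$3$1" "4 * w * z = P$2$1 - P$1$2"
    using w by (simp_all add: x_def y_def z_def)
  have cancel: "a = b" if "T * a = T * b" for a b :: real
    using that T by simp
  have prod: "T * (4 * (a * b)) = (4 * w * a) * (4 * w * b)" for a b
    unfolding w(2)[symmetric] by (simp add: power2_eq_square)
  have offdiag: "(P$3$2 - P$2$3) * (P$1$3 - P$3$1) = T * (P$1$2 + P$2$1)"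
    "(P$1$3 - P$3$1) * (P$2$1 - P$1$2) = T * (P$2$3 + P$3$2)"
    "(P$3$2 - P$2$3) * (P$2$1 - P$1$2) = T * (P$1$3 + P$3$1)"
    using cof(4-9) orth(3)[of 1 2, simplified] orth(4)[of 1 2, simplified]
      orth(3)[of 2 3, simplified] orth(4)[of 2 3, simplified]
      orth(3)[of 1 3, simplified] orth(4)[of 1 3, simplified]
    unfolding T_def
    by - (simp (no_asm_use) only: algebra_simps mult_1_left mult_1_right; linarith)+
  have xx: "4 * (x * x) = 1 + P$1$1 - P$2$2 - P$3$3"
    and yy: "4 * (y * y) = 1 - P$1$1 + P$2$2 - P$3$3"
    and zz: "4 * (z * z) = 1 - P$1$1 - P$2$2 + P$3$3"
    and xy: "4 * (x * y) = P$1$2 + P$2$1"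
    and yz: "4 * (y * z) = P$2$3 + P$3$2"
    and xz: "4 * (x * z) = P$1$3 + P$3$1"
    by (rule cancel, unfold prod wx, fact SO3_squared_differences[OF P, folded T_def] offdiag)+
  have ww: "4 * (w * w) = 1 + P$1$1 + P$2$2 + P$3$3"
    using w by (simp add: T_def power2_eq_square)
  show thesis
  proof
    show "w > 0" by fact
    show "w\<^sup>2 + x\<^sup>2 + y\<^sup>2 + z\<^sup>2 = 1"
      using ww xx yy zz by (simp add: power2_eq_square)
    show "P = quat_matrix w x y z"
      unfolding quat_matrix_def vec_eq_iff forall_3 vector_3 power2_eq_square
      using ww xx yy zz wx[unfolded mult.assoc] xy xz yz by (intro conjI; argo)
  qed
qed

section \<open>Comparison of distances between rotations\<close>

lemma cauchy_schwarz_3: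
  fixes x y z x' y' z' :: real
  shows "(x * x' + y * y' + z * z')\<^sup>2 \<le> (x\<^sup>2 + y\<^sup>2 + z\<^sup>2) * (x'\<^sup>2 + y'\<^sup>2 + z'\<^sup>2)"
proof -
  have "(x\<^sup>2 + y\<^sup>2 + z\<^sup>2) * (x'\<^sup>2 + y'\<^sup>2 + z'\<^sup>2) - (x * x' + y * y' + z * z')\<^sup>2 =
      (x * y' - y * x')\<^sup>2 + (x * z' - z * x')\<^sup>2 + (y * z' - z * y')\<^sup>2"
    by (simp add: power2_eq_square algebra_simps)
  moreover have "\<dots> \<ge> 0" by simp
  ultimately show ?thesis by linarith
qed

text \<open>
  The data of two unit quaternions that matter for inner products: their real parts \<open>u\<close>, \<open>v\<close> and the
  inner product \<open>b\<close> of their imaginary parts.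
\<close>

lemma SO3_pair_quaternions:
  assumes "P \<in> SO3" "Q \<in> SO3" "trace P > -1" "trace Q > -1"
  obtains u v b where "0 < u" "u \<le> 1" "0 < v" "v \<le> 1" "b\<^sup>2 \<le> (1 - u\<^sup>2) * (1 - v\<^sup>2)"
    "trace P = 4 * u\<^sup>2 - 1" "trace Q = 4 * v\<^sup>2 - 1"
    "P \<bullet> Q = 4 * (u * v + b)\<^sup>2 - 1" "transpose P \<bullet> Q = 4 * (u * v - b)\<^sup>2 - 1"
proof -
  obtain w x y z where p: "w > 0" "w\<^sup>2 + x\<^sup>2 + y\<^sup>2 + z\<^sup>2 = 1" "P = quat_matrix w x y z"
    using SO3_quaternion assms by metis
  obtain w' x' y' z' where q: "w' > 0" "w'\<^sup>2 + x'\<^sup>2 + y'\<^sup>2 + z'\<^sup>2 = 1" "Q = quat_matrix w' x' y' z'"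
    using SO3_quaternion assms by metis
  have "w\<^sup>2 \<le> 1\<^sup>2" "w'\<^sup>2 \<le> 1\<^sup>2"
    using p(2) q(2) zero_le_power2[of x] zero_le_power2[of y] zero_le_power2[of z]
      zero_le_power2[of x'] zero_le_power2[of y'] zero_le_power2[of z']
    unfolding one_power2 by linarith+
  then have le1: "w \<le> 1" "w' \<le> 1"
    using power2_le_imp_le zero_le_one by blast+
  show thesis
  proof
    have "x\<^sup>2 + y\<^sup>2 + z\<^sup>2 = 1 - w\<^sup>2" "x'\<^sup>2 + y'\<^sup>2 + z'\<^sup>2 = 1 - w'\<^sup>2"
      using p(2) q(2) by linarith+
    then show "(x * x' + y * y' + z * z')\<^sup>2 \<le> (1 - w\<^sup>2) * (1 - w'\<^sup>2)"
      using cauchy_schwarz_3[of x x' y y' z z'] by simp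
    show "P \<bullet> Q = 4 * (w * w' + (x * x' + y * y' + z * z'))\<^sup>2 - 1"
      unfolding p(3) q(3) by (subst inner_quat_matrix[OF p(2) q(2)]) (simp add: add.assoc)
    have "w\<^sup>2 + (-x)\<^sup>2 + (-y)\<^sup>2 + (-z)\<^sup>2 = 1" using p(2) by simp
    then show "transpose P \<bullet> Q = 4 * (w * w' - (x * x' + y * y' + z * z'))\<^sup>2 - 1"
      unfolding p(3) q(3) transpose_quat_matrix
      by (subst inner_quat_matrix[OF _ q(2)]) (simp_all add: algebra_simps)
  qed (use p q le1 trace_quat_matrix in auto)
qed

text \<open>
  The triangle inequality through the identity: two rotations within distance \<open>r\<close> of the identity are
  within distance \<open>2r\<close> of each other.
\<close>

lemma SO3_inner_ge_of_trace_ge: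
  assumes "P \<in> SO3" "Q \<in> SO3" and r: "0 \<le> r" "r \<le> pi / 2"
    and tr: "trace P \<ge> 1 + 2 * cos r" "trace Q \<ge> 1 + 2 * cos r"
  shows "P \<bullet> Q \<ge> 1 + 2 * cos (2 * r)"
proof -
  have c0: "cos r \<ge> 0" using r by (intro cos_ge_zero) auto
  then have tr': "trace P > -1" "trace Q > -1" using tr by linarith+
  obtain u v b where q: "0 < u" "u \<le> 1" "0 < v" "v \<le> 1" "b\<^sup>2 \<le> (1 - u\<^sup>2) * (1 - v\<^sup>2)"
    "trace P = 4 * u\<^sup>2 - 1" "trace Q = 4 * v\<^sup>2 - 1" "P \<bullet> Q = 4 * (u * v + b)\<^sup>2 - 1"
    using SO3_pair_quaternions[OF assms(1,2) tr'] by blast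
  define C where "C = 1 / 2 + cos r / 2"
  have C: "0 \<le> C" "C \<le> 1"
    using c0 cos_le_one[of r] unfolding C_def by argo+
  have Cuv: "C \<le> u\<^sup>2" "C \<le> v\<^sup>2"
    using tr q(6,7) unfolding C_def by argo+
  have u01: "0 \<le> 1 - u\<^sup>2" "1 - u\<^sup>2 \<le> 1 - C" "1 - v\<^sup>2 \<le> 1 - C" "0 \<le> 1 - v\<^sup>2"
    using q(1-4) Cuv by (simp_all add: power_le_one)
  have "C\<^sup>2 \<le> (u * v)\<^sup>2"
    unfolding power_mult_distrib power2_eq_square[of C]
    using mult_mono[OF Cuv] C by simp
  moreover have "0 \<le> u * v" using q(1,3) by simp
  ultimately have uv: "C \<le> u * v" by (rule power2_le_imp_le)
  have "(1 - u\<^sup>2) * (1 - v\<^sup>2) \<le> (1 - C) * (1 - C)"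
    using u01 C by (intro mult_mono) simp_all
  with q(5) have "b\<^sup>2 \<le> (1 - C)\<^sup>2"
    unfolding power2_eq_square[of "1 - C"] by (rule order_trans)
  then have "\<bar>b\<bar> \<le> 1 - C"
    using C by (simp add: abs_le_square_iff[symmetric])
  then have "cos r \<le> u * v + b" using uv C_def by argo
  then have "(cos r)\<^sup>2 \<le> (u * v + b)\<^sup>2" using c0 by (rule power_mono)
  then show ?thesis unfolding q(8) cos_double_cos by argo
qed

text \<open>
  In terms of quaternions, \<open>P \<bullet> Q - transpose P \<bullet> Q = 16 u v b\<close>, where the sign of \<open>b\<close> is the sign of the
  cosine of the angle at the identity in the geodesic triangle \<open>I, P, Q\<close>.  The assumption says that
  the side from \<open>P\<close> to \<open>Q\<close> is no longer than the side from \<open>I\<close> to \<open>Q\<close>.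
\<close>

lemma SO3_acute_angle:
  assumes "P \<in> SO3" "Q \<in> SO3" and tr: "trace P > 1" "trace Q > 1" and le: "trace Q \<le> P \<bullet> Q"
  shows "transpose P \<bullet> Q \<le> P \<bullet> Q"
proof -
  have tr': "trace P > -1" "trace Q > -1" using tr by linarith+
  obtain u v b where q: "0 < u" "u \<le> 1" "0 < v" "v \<le> 1" "b\<^sup>2 \<le> (1 - u\<^sup>2) * (1 - v\<^sup>2)"
    "trace P = 4 * u\<^sup>2 - 1" "trace Q = 4 * v\<^sup>2 - 1" 
    "P \<bullet> Q = 4 * (u * v + b)\<^sup>2 - 1" "transpose P \<bullet> Q = 4 * (u * v - b)\<^sup>2 - 1"
    using SO3_pair_quaternions[OF assms(1,2) tr'] by blast
  have half: "1/2 < u\<^sup>2" "1/2 < v\<^sup>2" using tr q(6,7) by argo+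
  have "b\<^sup>2 < (u * v)\<^sup>2"
  proof -
    have "(1 - u\<^sup>2) * (1 - v\<^sup>2) = (u * v)\<^sup>2 + (1 - u\<^sup>2 - v\<^sup>2)"
      by (simp add: power2_eq_square algebra_simps)
    then show ?thesis using q(5) half by argo
  qed
  then have "\<bar>b\<bar> < \<bar>u * v\<bar>" using abs_le_square_iff[of "u * v" b] by linarith
  then have pos: "0 \<le> u * v + b" using q(1,3) by (simp add: abs_mult)
  have "v\<^sup>2 \<le> (u * v + b)\<^sup>2" using le q(7,8) by argo
  then have "v \<le> u * v + b" using pos by (rule power2_le_imp_le)
  moreover have "u * v \<le> v" using q(1-4) by (simp add: mult_left_le_one_le)
  ultimately have "0 \<le> b" by linarith
  then have "0 \<le> 4 * (u * v) * b" using q(1,3) by simp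
  then show ?thesis unfolding q(8,9) by (simp add: power2_eq_square algebra_simps)
qed

lemma SO3_transpose_inner_self:
  assumes "Q \<in> SO3" "trace Q > -1"
  shows "Q \<bullet> Q - transpose Q \<bullet> Q = (1 + trace Q) * (3 - trace Q)"
proof -
  obtain w x y z where q: "w > 0" "w\<^sup>2 + x\<^sup>2 + y\<^sup>2 + z\<^sup>2 = 1" "Q = quat_matrix w x y z"
    using SO3_quaternion assms by metis
  have q': "w\<^sup>2 + (-x)\<^sup>2 + (-y)\<^sup>2 + (-z)\<^sup>2 = 1" using q(2) by simp
  have *: "w * w + x * x + y * y + z * z = 1" "w * w + - x * x + - y * y + - z * z = 2 * w\<^sup>2 - 1"
    using q(2) by (simp_all add: power2_eq_square)
  show ?thesis
    unfolding q(3) transpose_quat_matrix inner_quat_matrix[OF q(2) q(2)] inner_quat_matrix[OF q' q(2)]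
      trace_quat_matrix[OF q(2)] * by (simp add: power2_eq_square algebra_simps)
qed

section \<open>Estimates for the trigonometric functions\<close>

text \<open>
  The factor \<open>\<theta> / sin \<theta>\<close>, extended continuously by the value 1 at \<open>\<theta> = 0\<close>.
\<close>

definition inv_sinc :: "real \<Rightarrow> real" where
  "inv_sinc \<theta> = (if \<theta> = 0 then 1 else \<theta> / sin \<theta>)"

lemma inv_sinc_ge_1:
  assumes "0 \<le> \<theta>" "\<theta> < pi"
  shows "1 \<le> inv_sinc \<theta>"
  using assms sin_gt_zero[of \<theta>] sin_x_le_x[of \<theta>] by (auto simp: inv_sinc_def le_divide_eq)

lemma tendsto_cos_sub_one_over_square:
  "((\<lambda>\<theta>::real. (cos \<theta> - 1) / \<theta>\<^sup>2) \<longlongrightarrow> - 1 / 2) (at 0)"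
proof -
  have "((\<lambda>h::real. sin h / h) \<longlongrightarrow> 1) (at 0)"
    using DERIV_sin[of "0::real"] by (simp add: DERIV_def)
  moreover have "filterlim (\<lambda>\<theta>::real. \<theta> / 2) (at 0) (at 0)"
    unfolding filterlim_at by (auto intro!: tendsto_eq_intros eventually_neq_at_within)
  ultimately have "((\<lambda>\<theta>::real. sin (\<theta> / 2) / (\<theta> / 2)) \<longlongrightarrow> 1) (at 0)"
    by (rule filterlim_compose)
  then have "((\<lambda>\<theta>::real. - 1 / 2 * (sin (\<theta> / 2) / (\<theta> / 2))\<^sup>2) \<longlongrightarrow> - 1 / 2 * 1\<^sup>2) (at 0)"
    by (intro tendsto_intros)
  moreover have "- 1 / 2 * (sin (\<theta> / 2) / (\<theta> / 2))\<^sup>2 = (cos \<theta> - 1) / \<theta>\<^sup>2" for \<theta> :: real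
    using cos_double_sin[of "\<theta> / 2"] by (simp add: power_divide)
  ultimately show ?thesis by simp
qed

text \<open>
  The function \<open>arccos\<close> is not differentiable at 1, but its square is, from the left.  This makes the
  squared distance differentiable on the diagonal.
\<close>

lemma has_real_derivative_arccos_square:
  assumes "-1 < u" "u \<le> 1"
  shows "((\<lambda>u. (arccos u)\<^sup>2) has_real_derivative - 2 * inv_sinc (arccos u)) (at u within {-1..1})"
proof (cases "u = 1")
  case True
  have nz: "arccos y \<noteq> 0" if "y \<in> {-1..1}" "y \<noteq> 1" for y
    using that by (metis arccos_1 arccos_eq_iff abs_le_iff atLeastAtMost_iff abs_one minus_le_iff order_refl)
  have ev: "\<forall>\<^sub>F y in at 1 within {-1..1}. y \<in> {-1..1::real} \<and> y \<noteq> 1"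
    by (simp add: eventually_at_filter)
  have "(arccos \<longlongrightarrow> arccos 1) (at 1 within {-1..1})"
    using continuous_on_arccos'[unfolded continuous_on_def, rule_format, of 1] by simp
  then have "filterlim arccos (at 0) (at 1 within {-1..1})"
    unfolding filterlim_at using ev nz by (auto elim!: eventually_mono)
  with tendsto_cos_sub_one_over_square
  have "((\<lambda>y. (cos (arccos y) - 1) / (arccos y)\<^sup>2) \<longlongrightarrow> - 1 / 2) (at 1 within {-1..1})"
    by (rule filterlim_compose)
  then have "((\<lambda>y. inverse ((cos (arccos y) - 1) / (arccos y)\<^sup>2)) \<longlongrightarrow> inverse (- 1 / 2)) (at 1 within {-1..1})"
    by (rule tendsto_inverse) simp
  moreover have "\<forall>\<^sub>F y in at 1 within {-1..1}.
      inverse ((cos (arccos y) - 1) / (arccos y)\<^sup>2) = (arccos y)\<^sup>2 / (y - 1)"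
    using ev by (rule eventually_mono) auto
  ultimately have "((\<lambda>y. (arccos y)\<^sup>2 / (y - 1)) \<longlongrightarrow> inverse (- 1 / 2)) (at 1 within {-1..1})"
    by (rule Lim_transform_eventually)
  then show ?thesis
    using True by (simp add: has_field_derivative_iff inv_sinc_def)
next
  case False
  with assms have u: "-1 < u" "u < 1" by auto
  have "arccos u \<noteq> 0" using u by (metis arccos_lt_bounded less_irrefl)
  then have "((\<lambda>u. (arccos u)\<^sup>2) has_real_derivative - 2 * inv_sinc (arccos u)) (at u)"
    using u by (auto intro!: derivative_eq_intros simp: inv_sinc_def sin_arccos_abs sin_arccos field_simps)
  then show ?thesis by (rule has_field_derivative_at_within)
qed

lemma square_le_one_sub_cos:
  assumes "0 \<le> d" "d \<le> pi / 3"
  shows "d\<^sup>2 \<le> 4 * (1 - cos d)"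
proof -
  define x where "x = d / 2"
  have x: "0 \<le> x" "x \<le> pi / 6" using assms by (simp_all add: x_def)
  have cos: "sqrt 3 / 2 \<le> cos x"
    using cos_monotone_0_pi_le[of x "pi / 6"] x by (simp add: cos_30)
  have "x \<le> tan x" using abs_tan_ge[of x] x tan_gt_zero[of x] by (cases "x = 0") auto
  moreover have "0 < cos x" using cos by (meson less_le_trans half_gt_zero real_sqrt_gt_zero zero_less_numeral)
  ultimately have "x * cos x \<le> sin x" by (simp add: tan_def field_simps)
  moreover have "x * (sqrt 3 / 2) \<le> x * cos x" using cos x by (intro mult_left_mono)
  ultimately have "(x * (sqrt 3 / 2))\<^sup>2 \<le> (sin x)\<^sup>2" using x by (intro power_mono) auto
  then have "3 / 4 * x\<^sup>2 \<le> (sin x)\<^sup>2" by (simp add: power_mult_distrib power_divide)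
  moreover have "cos d = 1 - 2 * (sin x)\<^sup>2" using cos_double_sin[of x] by (simp add: x_def)
  moreover have "d\<^sup>2 = 4 * x\<^sup>2" by (simp add: x_def power_divide)
  moreover have "0 \<le> x\<^sup>2" by simp
  ultimately show ?thesis by argo
qed

section \<open>Gradients of radial functions\<close>

lemma metric_SO3_inner:
  assumes "R \<in> SO3"
  shows "metric_SO3 R X V = (X \<bullet> V) / 2"
  using inner_mult_SO3(2)[OF assms] by (simp add: metric_SO3_def)

text \<open>
  Every tangent vector is the velocity of a curve in \<open>SO3\<close>.  For \<open>V = R A\<close> and \<open>A = n B\<close>, where the axial
  vector of \<open>B\<close> has norm 1, the curve is \<open>R exp (s A)\<close>, given by the formula of Rodrigues and seen to lie
  in \<open>SO3\<close> by means of the quaternion with real part \<open>cos (n s / 2)\<close>.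
\<close>

lemma SO3_curve:
  assumes R: "R \<in> SO3" and V: "V \<in> tangent_SO3 R"
  obtains \<gamma> where "\<And>s. \<gamma> s \<in> SO3" "\<gamma> 0 = R" "(\<gamma> has_vector_derivative V) (at 0)"
proof -
  obtain A where A: "V = R ** A" "transpose A = - A" using V by (auto simp: tangent_SO3_def)
  have skew: "A$j$i = - A$i$j" for i j
    using arg_cong[OF A(2), of "\<lambda>M. M$i$j"] by (simp add: transpose_def)
  have diag: "A$i$i = 0" for i using skew[of i i] by simp
  define n where "n = norm (vector [A$3$2, A$1$3, A$2$1] :: real^3)"
  show thesis
  proof (cases "n = 0")
    case True
    then have "A$3$2 = 0" "A$1$3 = 0" "A$2$1 = 0"
      by (simp_all add: n_def vec_eq_iff forall_3)
    then have "A = 0"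
      using skew[of 3 2] skew[of 1 3] skew[of 2 1] diag by (simp add: vec_eq_iff forall_3)
    then have "V = 0" using A by simp
    then show thesis using that[of "\<lambda>_. R"] R by simp
  next
    case False
    define x y z where "x = A$3$2 / n" "y = A$1$3 / n" "z = A$2$1 / n"
    have n2: "n\<^sup>2 = (A$3$2)\<^sup>2 + (A$1$3)\<^sup>2 + (A$2$1)\<^sup>2"
      unfolding n_def power2_norm_eq_inner by (simp add: inner_vec_def sum_3 power2_eq_square)
    have "x\<^sup>2 + y\<^sup>2 + z\<^sup>2 = n\<^sup>2 / n\<^sup>2"
      unfolding n2 x_y_z_def power_divide add_divide_distrib ..
    then have unit: "x\<^sup>2 + y\<^sup>2 + z\<^sup>2 = 1"
      using False by simp
    define B where "B = (1 / n) *\<^sub>R A"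
    define \<gamma> where "\<gamma> s = R + (2 * sin (n * s / 2) * cos (n * s / 2)) *\<^sub>R (R ** B)
        + (2 * (sin (n * s / 2))\<^sup>2) *\<^sub>R (R ** (B ** B))" for s
    have "\<gamma> s = R ** quat_matrix (cos (n * s / 2)) (sin (n * s / 2) * x) (sin (n * s / 2) * y) (sin (n * s / 2) * z)"
      for s
    proof -
      define S where "S = sin (n * s / 2)"
      define C where "C = cos (n * s / 2)"
      have c: "C\<^sup>2 = 1 - S\<^sup>2 * (x\<^sup>2 + y\<^sup>2 + z\<^sup>2)" unfolding unit S_def C_def by (simp add: cos_squared_eq)
      have B: "B = vector [vector [0, -z, y], vector [z, 0, -x], vector [-y, x, 0]]"
        using skew[of 3 2] skew[of 1 3] skew[of 2 1] diag
        by (simp add: B_def x_y_z_def vec_eq_iff forall_3)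
      have "mat 1 + (2 * S * C) *\<^sub>R B + (2 * S\<^sup>2) *\<^sub>R (B ** B) = quat_matrix C (S * x) (S * y) (S * z)"
        unfolding B quat_matrix_def c
        by (simp add: matrix_matrix_mult_def mat_def sum_3 vec_eq_iff forall_3 power2_eq_square algebra_simps)
      moreover have "\<gamma> s = R ** (mat 1 + (2 * S * C) *\<^sub>R B + (2 * S\<^sup>2) *\<^sub>R (B ** B))"
        by (simp add: \<gamma>_def S_def C_def matrix_add_ldistrib matrix_mult_scaleR_right)
      ultimately show ?thesis by (simp add: S_def C_def)
    qed
    moreover have "(cos t)\<^sup>2 + (sin t * x)\<^sup>2 + (sin t * y)\<^sup>2 + (sin t * z)\<^sup>2 = 1" for t
      using unit by (simp add: power_mult_distrib distrib_left[symmetric] add.assoc)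
    ultimately have "\<gamma> s \<in> SO3" for s by (simp add: SO3_mult R quat_matrix_SO3)
    moreover have "\<gamma> 0 = R" by (simp add: \<gamma>_def)
    moreover have "(\<gamma> has_vector_derivative n *\<^sub>R (R ** B)) (at 0)"
      unfolding \<gamma>_def by (auto intro!: derivative_eq_intros)
    moreover have "n *\<^sub>R (R ** B) = V"
      using False by (simp add: B_def A(1) matrix_mult_scaleR_right)
    ultimately show thesis using that by metis
  qed
qed

text \<open>
  Two derivatives within \<open>SO3\<close> agree on tangent vectors, because both give the derivative of \<open>f\<close> along
  curves.
\<close>

lemma has_gradient_SO3_unique:
  assumes R: "R \<in> SO3" and "has_gradient_SO3 f G R" "has_gradient_SO3 f H R"
  shows "G = H"
proof -
  obtain D D' where G: "G \<in> tangent_SO3 R" "(f has_derivative D) (at R within SO3)"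
      "\<And>V. V \<in> tangent_SO3 R \<Longrightarrow> D V = metric_SO3 R G V"
    and H: "H \<in> tangent_SO3 R" "(f has_derivative D') (at R within SO3)"
      "\<And>V. V \<in> tangent_SO3 R \<Longrightarrow> D' V = metric_SO3 R H V"
    using assms(2,3) unfolding has_gradient_SO3_def by blast
  define V where "V = G - H"
  obtain A B where "G = R ** A" "transpose A = - A" "H = R ** B" "transpose B = - B"
    using G(1) H(1) by (auto simp: tangent_SO3_def)
  then have "V = R ** (A - B)" "transpose (A - B) = - (A - B)"
    by (simp_all add: V_def matrix_mult_diff_right transpose_diff)
  then have V: "V \<in> tangent_SO3 R" by (auto simp: tangent_SO3_def)
  obtain \<gamma> where \<gamma>: "\<And>s. \<gamma> s \<in> SO3" "\<gamma> 0 = R" "(\<gamma> has_vector_derivative V) (at 0)"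
    using SO3_curve[OF R V] by blast
  have chain: "((\<lambda>s. f (\<gamma> s)) has_derivative (\<lambda>h. E (h *\<^sub>R V))) (at 0)"
    if "(f has_derivative E) (at R within SO3)" for E
  proof -
    have "(f has_derivative E) (at (\<gamma> 0) within range \<gamma>)"
      unfolding \<gamma>(2) by (rule has_derivative_subset[OF that]) (use \<gamma>(1) in auto)
    then show ?thesis
      by (rule has_derivative_in_compose[OF \<gamma>(3)[unfolded has_vector_derivative_def]])
  qed
  have "(\<lambda>h. D (h *\<^sub>R V)) = (\<lambda>h. D' (h *\<^sub>R V))"
    by (rule has_derivative_unique[OF chain[OF G(2)] chain[OF H(2)]])
  then have "D (1 *\<^sub>R V) = D' (1 *\<^sub>R V)" by metis
  then have "G \<bullet> V = H \<bullet> V"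
    using G(3)[OF V] H(3)[OF V] by (simp add: metric_SO3_inner[OF R])
  then have "V \<bullet> V = 0" by (simp add: V_def inner_diff_left)
  then show ?thesis by (simp add: V_def)
qed

lemma gradient_SO3_eqI:
  assumes "R \<in> SO3" "has_gradient_SO3 f G R"
  shows "gradient_SO3 f R = G"
  unfolding gradient_SO3_def using assms has_gradient_SO3_unique by blast

text \<open>
  The gradient of a function of the squared distance to \<open>Q\<close>.  Here \<open>Q - R Q\<^sup>T R = R (M - M\<^sup>T)\<close> with
  \<open>M = R\<^sup>T Q\<close>; since \<open>log M = (d / (2 sin d)) (M - M\<^sup>T)\<close>, this is \<open>- 2 g'(d\<^sup>2) R log M\<close>.
\<close>

lemma gradient_SO3_radial:
  fixes K :: "real^3^3 \<Rightarrow> real^3^3 \<Rightarrow> real" and g g' :: "real \<Rightarrow> real"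
  assumes K: "\<And>X Y. X \<in> SO3 \<Longrightarrow> Y \<in> SO3 \<Longrightarrow> K X Y = g ((dist_SO3 X Y)\<^sup>2)"
    and g: "\<And>s. s \<ge> 0 \<Longrightarrow> (g has_real_derivative g' s) (at s within {0..})"
    and R: "R \<in> SO3" and Q: "Q \<in> SO3" and pos: "R \<bullet> Q > -1"
  shows "gradient_SO3 (\<lambda>X. K X Q) R =
    - (g' ((dist_SO3 R Q)\<^sup>2) * inv_sinc (dist_SO3 R Q)) *\<^sub>R (Q - R ** transpose Q ** R)"
    (is "_ = ?k *\<^sub>R ?W")
proof (rule gradient_SO3_eqI[OF R])
  define u where "u X = (X \<bullet> Q - 1) / 2" for X
  define D where "D V = g' ((dist_SO3 R Q)\<^sup>2) * (- 2 * inv_sinc (dist_SO3 R Q) * ((V \<bullet> Q) / 2))"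
    for V :: "real^3^3"
  have d: "dist_SO3 X Q = arccos (u X)" for X by (simp add: dist_SO3_inner u_def)
  have u_range: "u ` SO3 \<subseteq> {-1..1}"
  proof safe
    fix X assume "X \<in> SO3"
    from SO3_inner_bounds[OF this Q] show "u X \<in> {-1..1}" by (simp add: u_def)
  qed
  have "(u has_derivative (\<lambda>V. (V \<bullet> Q) / 2)) (at R within SO3)"
    unfolding u_def by (auto intro!: derivative_eq_intros)
  moreover have "((\<lambda>v. (arccos v)\<^sup>2) has_derivative (*) (- 2 * inv_sinc (arccos (u R)))) (at (u R) within u ` SO3)"
    using has_real_derivative_arccos_square[of "u R"] pos u_range R
    by (intro has_derivative_subset[OF _ u_range]) (auto simp: has_field_derivative_def u_def)
  ultimately have 1: "((\<lambda>X. (arccos (u X))\<^sup>2) has_derivative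
      (\<lambda>V. - 2 * inv_sinc (arccos (u R)) * ((V \<bullet> Q) / 2))) (at R within SO3)"
    by (rule has_derivative_in_compose)
  have "(g has_derivative (*) (g' ((arccos (u R))\<^sup>2))) (at ((arccos (u R))\<^sup>2) within {0..})"
    using g[of "(arccos (u R))\<^sup>2"] by (simp add: has_field_derivative_def)
  then have "(g has_derivative (*) (g' ((arccos (u R))\<^sup>2)))
      (at ((arccos (u R))\<^sup>2) within (\<lambda>X. (arccos (u X))\<^sup>2) ` SO3)"
    by (rule has_derivative_subset) auto
  with 1 have "((\<lambda>X. g ((arccos (u X))\<^sup>2)) has_derivative
     (\<lambda>V. g' ((arccos (u R))\<^sup>2) * (- 2 * inv_sinc (arccos (u R)) * ((V \<bullet> Q) / 2)))) (at R within SO3)"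
    by (rule has_derivative_in_compose)
  then have deriv: "((\<lambda>X. K X Q) has_derivative D) (at R within SO3)"
    unfolding D_def d by (rule has_derivative_transform[OF R, rotated]) (simp add: K[OF _ Q] d)
  have W: "?W = R ** (transpose R ** Q - transpose (transpose R ** Q))"
    using SO3_orthogonal(2)[OF R] by (simp add: matrix_mult_diff_right matrix_transpose_mul matrix_mul_assoc)
  have tangent: "?k *\<^sub>R ?W \<in> tangent_SO3 R"
  proof -
    define M where "M = transpose R ** Q"
    have "?k *\<^sub>R ?W = R ** (?k *\<^sub>R (M - transpose M))"
      unfolding W M_def by (simp only: matrix_mult_scaleR_right)
    moreover have "transpose (?k *\<^sub>R (M - transpose M)) = - (?k *\<^sub>R (M - transpose M))"
      by (simp add: transpose_def vec_eq_iff algebra_simps)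
    ultimately show ?thesis unfolding tangent_SO3_def by blast
  qed
  have "D V = metric_SO3 R (?k *\<^sub>R ?W) V" if V: "V \<in> tangent_SO3 R" for V
  proof -
    obtain A where A: "V = R ** A" "transpose A = - A" using V by (auto simp: tangent_SO3_def)
    \<comment> \<open>The two summands of the gradient direction contribute equally, since \<open>A\<close> is skew.\<close>
    have "(R ** (transpose Q ** R)) \<bullet> V = (transpose Q ** R) \<bullet> A"
      unfolding A(1) by (rule inner_mult_SO3(1)[OF R])
    also have "\<dots> = (transpose R ** Q) \<bullet> transpose A"
      using inner_transpose[of "transpose Q ** R" A] by (simp add: matrix_transpose_mul)
    also have "\<dots> = - (Q \<bullet> V)"
      unfolding A inner_mult_left using matrix_mult_scaleR_right[of R "- 1" A] by simp
    finally have "?W \<bullet> V = 2 * (Q \<bullet> V)"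
      by (simp add: inner_diff_left matrix_mul_assoc)
    then show ?thesis
      unfolding metric_SO3_inner[OF R] D_def by (simp add: inner_commute)
  qed
  with tangent deriv show "has_gradient_SO3 (\<lambda>X. K X Q) (?k *\<^sub>R ?W) R"
    unfolding has_gradient_SO3_def by blast
qed

section \<open>A maximum principle for finite families\<close>

text \<open>
  If each member of a finite family decays at rate \<open>l\<close> at those times at which it is the largest one,
  then the whole family lies below a decaying exponential.  After multiplication by \<open>exp (l t)\<close> and
  subtraction of \<open>\<epsilon> t\<close>, whichever member is the largest at a positive time has negative derivative
  there, so the maximum over the family and a compact time interval can only be attained at time 0.
\<close>

lemma max_exp_decay:
  fixes f :: "'a \<Rightarrow> real \<Rightarrow> real"
  assumes fin: "finite S"
    and cont: "\<And>a. a \<in> S \<Longrightarrow> continuous_on {0..} (f a)"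
    and deriv: "\<And>a t. a \<in> S \<Longrightarrow> 0 < t \<Longrightarrow> (f a has_real_derivative f' a t) (at t)"
    and decay: "\<And>a t. a \<in> S \<Longrightarrow> 0 < t \<Longrightarrow> (\<And>b. b \<in> S \<Longrightarrow> f b t \<le> f a t) \<Longrightarrow> f' a t \<le> - l * f a t"
    and init: "\<And>a. a \<in> S \<Longrightarrow> f a 0 \<le> M"
    and a: "a \<in> S" and t: "0 \<le> t"
  shows "f a t \<le> M * exp (- l * t)"
proof -
  have scaled: "exp (l * t) * f a t \<le> M + \<epsilon> * t" if \<epsilon>: "\<epsilon> > 0" for \<epsilon>
  proof (rule ccontr)
    assume neg: "\<not> ?thesis"
    define h where "h b s = exp (l * s) * f b s - \<epsilon> * s" for b s
    have hcont: "continuous_on {0..t} (h b)" if "b \<in> S" for b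
      unfolding h_def using cont[OF that]
      by (intro continuous_intros) (auto intro: continuous_on_subset)
    have "\<exists>m\<in>{0..t}. \<forall>s\<in>{0..t}. h b s \<le> h b m" if "b \<in> S" for b
      using t by (intro continuous_attains_sup hcont that) auto
    then obtain m where m: "\<And>b. b \<in> S \<Longrightarrow> m b \<in> {0..t}"
        "\<And>b s. b \<in> S \<Longrightarrow> s \<in> {0..t} \<Longrightarrow> h b s \<le> h b (m b)"
      by metis
    have "finite ((\<lambda>b. h b (m b)) ` S)" "(\<lambda>b. h b (m b)) ` S \<noteq> {}" using fin a by auto
    then obtain b where b: "b \<in> S" "h b (m b) = Max ((\<lambda>b. h b (m b)) ` S)"
      using Max_in by (metis (no_types, lifting) imageE)
    have bmax: "h c s \<le> h b (m b)" if "c \<in> S" "s \<in> {0..t}" for c s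
    proof -
      have "h c s \<le> h c (m c)" using m that by blast
      also have "\<dots> \<le> h b (m b)" unfolding b(2) using fin that by (intro Max_ge) auto
      finally show ?thesis .
    qed
    have "h a t > M" using neg by (simp add: h_def)
    then have "h b (m b) > M" using bmax[OF a, of t] t by simp
    moreover have "h b 0 \<le> M" using init[OF b(1)] by (simp add: h_def)
    ultimately have "m b \<noteq> 0" by force
    then have pos: "0 < m b" using m(1)[OF b(1)] by simp
    have "f c (m b) \<le> f b (m b)" if "c \<in> S" for c
      using bmax[OF that m(1)[OF b(1)]] by (simp add: h_def)
    then have "f' b (m b) \<le> - l * f b (m b)" using decay[OF b(1) pos] by blast
    then have "exp (l * m b) * (f' b (m b) + l * f b (m b)) \<le> 0"
      by (simp add: mult_le_0_iff)
    moreover have d: "(h b has_real_derivative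
        (exp (l * m b) * (f' b (m b) + l * f b (m b)) - \<epsilon>)) (at (m b))" 
      unfolding h_def by (auto intro!: derivative_eq_intros deriv[OF b(1) pos] simp: algebra_simps)
    ultimately have "exp (l * m b) * (f' b (m b) + l * f b (m b)) - \<epsilon> < 0" using \<epsilon> by simp
    \<comment> \<open>A negative derivative means larger values just before the maximizing time.\<close>
    from DERIV_neg_dec_left[OF d this] obtain e where e: "e > 0"
      "\<And>x. 0 < x \<Longrightarrow> x < e \<Longrightarrow> h b (m b) < h b (m b - x)" by blast
    define x where "x = min (e / 2) (m b)"
    have "h b (m b) < h b (m b - x)" using e pos by (intro e(2)) (auto simp: x_def)
    moreover have "m b - x \<in> {0..t}" using m(1)[OF b(1)] e pos by (auto simp: x_def)
    ultimately show False using bmax[OF b(1), of "m b - x"] by linarith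
  qed
  have "exp (l * t) * f a t \<le> M"
  proof (rule field_le_epsilon)
    fix e :: real assume "e > 0"
    then have "exp (l * t) * f a t \<le> M + e / (t + 1) * t" using t by (intro scaled) simp
    also have "e / (t + 1) * t \<le> e" using t \<open>e > 0\<close> by (simp add: field_simps)
    finally show "exp (l * t) * f a t \<le> M + e" by simp
  qed
  then show ?thesis by (simp add: exp_minus field_simps)
qed

section \<open>Attraction and synchronization\<close>

text \<open>
  At a pair \<open>i\<close>, \<open>j\<close> of maximal distance, every summand of the velocity of \<open>X i\<close> has a nonnegative component in
  the direction of \<open>X j\<close>, and the summand \<open>k = j\<close> is bounded below.
\<close>

lemma attraction_lower_bound:
  fixes X :: "'i \<Rightarrow> real^3^3"
  assumes fin: "finite I" and i: "i \<in> I" and j: "j \<in> I"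
    and SO3: "\<And>k. k \<in> I \<Longrightarrow> X k \<in> SO3"
    and near: "\<And>k l. k \<in> I \<Longrightarrow> l \<in> I \<Longrightarrow> 1 < X k \<bullet> X l"
    and far: "\<And>k l. k \<in> I \<Longrightarrow> l \<in> I \<Longrightarrow> X i \<bullet> X j \<le> X k \<bullet> X l"
    and c: "0 \<le> c" and a: "\<And>k. k \<in> I \<Longrightarrow> c \<le> a k"
  shows "2 * c * (3 - X i \<bullet> X j) \<le> (\<Sum>k\<in>I. a k *\<^sub>R (X k - X i ** transpose (X k) ** X i)) \<bullet> X j"
proof -
  define Q where "Q = transpose (X i) ** X j"
  define P where "P k = transpose (X i) ** X k" for k
  have Q: "Q \<in> SO3" "trace Q = X i \<bullet> X j"
    using SO3 i j by (auto simp: Q_def SO3_transpose_mult trace_transpose_mult)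
  have P: "P k \<in> SO3" "trace (P k) = X i \<bullet> X k" if "k \<in> I" for k
    using SO3 i that by (auto simp: P_def SO3_transpose_mult trace_transpose_mult)
  have PQ: "P k \<bullet> Q = X k \<bullet> X j" for k
    unfolding P_def Q_def by (rule inner_mult_SO3(2)[OF SO3[OF i]])
  have summand: "(X k - X i ** transpose (X k) ** X i) \<bullet> X j = P k \<bullet> Q - transpose (P k) \<bullet> Q" for k
  proof -
    have "(X i ** transpose (X k) ** X i) \<bullet> X j = transpose (P k) \<bullet> Q"
      unfolding matrix_mul_assoc[symmetric] inner_mult_left[of "X i"]
      by (simp add: P_def Q_def matrix_transpose_mul)
    then show ?thesis by (simp add: inner_diff_left PQ)
  qed
  have nonneg: "0 \<le> a k * (P k \<bullet> Q - transpose (P k) \<bullet> Q)" if k: "k \<in> I" for k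
  proof -
    have "transpose (P k) \<bullet> Q \<le> P k \<bullet> Q"
      using P[OF k] Q near[OF i k] near[OF i j] far[OF k j]
      by (intro SO3_acute_angle) (simp_all add: PQ)
    then show ?thesis using a[OF k] c by simp
  qed
  have "2 * c * (3 - X i \<bullet> X j) \<le> a j * ((1 + trace Q) * (3 - trace Q))"
  proof -
    have "2 * (3 - X i \<bullet> X j) \<le> (1 + trace Q) * (3 - trace Q)"
      unfolding Q(2) using near[OF i j] SO3_inner_bounds(2)[OF SO3[OF i] SO3[OF j]]
      by (intro mult_right_mono) simp_all
    with a[OF j] c have "c * (2 * (3 - X i \<bullet> X j)) \<le> a j * ((1 + trace Q) * (3 - trace Q))"
      using SO3_inner_bounds(2)[OF SO3[OF i] SO3[OF j]] near[OF i j] unfolding Q(2)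
      by (intro mult_mono mult_nonneg_nonneg) simp_all
    then show ?thesis by (simp add: mult.assoc mult.left_commute)
  qed
  also have "\<dots> = a j * (P j \<bullet> Q - transpose (P j) \<bullet> Q)"
    using SO3_transpose_inner_self[of Q] Q near[OF i j] by (simp add: P_def Q_def)
  also have "\<dots> \<le> (\<Sum>k\<in>I. a k * (P k \<bullet> Q - transpose (P k) \<bullet> Q))"
    using fin j nonneg by (intro member_le_sum) auto
  also have "\<dots> = (\<Sum>k\<in>I. a k *\<^sub>R (X k - X i ** transpose (X k) ** X i)) \<bullet> X j"
    by (simp add: inner_sum_left summand)
  finally show ?thesis .
qed

theorem theorem5p13:
  fixes K :: "real^3^3 \<Rightarrow> real^3^3 \<Rightarrow> real"
    and g g' :: "real \<Rightarrow> real"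
    and r c :: real
    and N :: nat
    and R0 :: "nat \<Rightarrow> real^3^3"
    and R :: "nat \<Rightarrow> real \<Rightarrow> real^3^3"
  assumes K_form: "\<And>X Y. X \<in> SO3 \<Longrightarrow> Y \<in> SO3 \<Longrightarrow> K X Y = g ((dist_SO3 X Y)\<^sup>2)"
    and g_deriv: "\<And>s. s \<ge> 0 \<Longrightarrow> (g has_real_derivative g' s) (at s within {0..})"
    and g'_lipschitz: "local_lipschitz (UNIV :: real set) {0..} (\<lambda>_. g')"
    and r: "0 < r" "r < pi / 6"
    and N: "0 < N"
    and c: "0 < c" "\<And>s. s \<in> {0..4 * r\<^sup>2} \<Longrightarrow> g' s \<ge> c"
    and init: "\<And>i. i \<in> {1..N} \<Longrightarrow> R0 i \<in> closure (disc_SO3 r)"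
    and sol: "global_solution N r K R0 R"
  shows "\<forall>i \<in> {1..N}. \<forall>j \<in> {1..N}.
           ((\<lambda>t. dist_SO3 (R i t) (R j t)) \<longlongrightarrow> 0) at_top \<and>
           (\<exists>A > 0. \<exists>\<mu> > 0. \<forall>t \<ge> 0. dist_SO3 (R i t) (R j t) \<le> A * exp (- \<mu> * t))"
proof -
  define I where "I = {1..N}"
  have "r \<le> pi" "0 \<le> cos (2 * r)" using r by (auto intro!: cos_ge_zero)
  have sol_cont: "continuous_on {0..} (R i)" 
    and sol_disc: "t \<ge> 0 \<Longrightarrow> R i t \<in> closure (disc_SO3 r)"
    and sol_ode: "t > 0 \<Longrightarrow> (R i has_vector_derivative
            - ((1 / real N) *\<^sub>R (\<Sum>j\<in>I. gradient_SO3 (\<lambda>X. K X (R j t)) (R i t)))) (at t)"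
    if "i \<in> I" for i t
    using sol that unfolding global_solution_def I_def by blast+
  have mem: "R i t \<in> SO3" if "i \<in> I" "t \<ge> 0" for i t
    using closure_disc_SO3(1)[OF sol_disc[OF that] \<open>r \<le> pi\<close>] .
  have inner_ge: "1 + 2 * cos (2 * r) \<le> R i t \<bullet> R j t" if "i \<in> I" "j \<in> I" "t \<ge> 0" for i j t
    using that r closure_disc_SO3[OF sol_disc \<open>r \<le> pi\<close>]
    by (intro SO3_inner_ge_of_trace_ge) simp_all
  have cos2r: "1 / 2 < cos (2 * r)"
    using cos_monotone_0_pi[of "2 * r" "pi / 3"] r by (simp add: cos_60)
  have near: "1 < R i t \<bullet> R j t" if "i \<in> I" "j \<in> I" "t \<ge> 0" for i j t
    using inner_ge[OF that] cos2r by linarith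
  have cos_dist: "cos (dist_SO3 (R i t) (R j t)) = (R i t \<bullet> R j t - 1) / 2"
    and dist_nonneg: "0 \<le> dist_SO3 (R i t) (R j t)"
    and dist_le: "dist_SO3 (R i t) (R j t) \<le> 2 * r"
    if ij: "i \<in> I" "j \<in> I" and t: "t \<ge> 0" for i j t
  proof -
    define q where "q = (R i t \<bullet> R j t - 1) / 2"
    have q: "-1 \<le> q" "q \<le> 1" "cos (2 * r) \<le> q"
      using SO3_inner_bounds[OF mem[OF ij(1) t] mem[OF ij(2) t]] inner_ge[OF ij t]
      unfolding q_def by argo+
    have d: "dist_SO3 (R i t) (R j t) = arccos q" by (simp add: dist_SO3_inner q_def)
    show "cos (dist_SO3 (R i t) (R j t)) = (R i t \<bullet> R j t - 1) / 2"
      unfolding d cos_arccos[OF q(1,2)] by (simp add: q_def)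
    show "0 \<le> dist_SO3 (R i t) (R j t)"
      unfolding d using arccos_lbound[OF q(1,2)] .
    have "arccos q \<le> arccos (cos (2 * r))"
      using q by (intro arccos_le_arccos) auto
    then show "dist_SO3 (R i t) (R j t) \<le> 2 * r"
      unfolding d using r by (simp add: arccos_cos)
  qed
  \<comment> \<open>The system in the form \<open>R\<^sub>i' = W\<^sub>i / N\<close>, with weights that are bounded below.\<close>
  define a where "a t i k = g' ((dist_SO3 (R i t) (R k t))\<^sup>2) * inv_sinc (dist_SO3 (R i t) (R k t))"
    for t i k
  define W where "W t i = (\<Sum>k\<in>I. a t i k *\<^sub>R (R k t - R i t ** transpose (R k t) ** R i t))" for t i
  have weight: "c \<le> a t i k" if "i \<in> I" "k \<in> I" "t \<ge> 0" for t i k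
  proof -
    let ?d = "dist_SO3 (R i t) (R k t)"
    have "?d\<^sup>2 \<le> (2 * r)\<^sup>2" using dist_nonneg[OF that] dist_le[OF that] by (intro power_mono)
    then have "c \<le> g' (?d\<^sup>2)" by (intro c(2)) (simp add: power_mult_distrib)
    moreover have "1 \<le> inv_sinc ?d"
      using dist_nonneg[OF that] dist_le[OF that] r by (intro inv_sinc_ge_1) auto
    ultimately have "c * 1 \<le> a t i k" unfolding a_def using c(1) by (intro mult_mono) auto
    then show ?thesis by simp
  qed
  have ode: "(R i has_vector_derivative (1 / real N) *\<^sub>R W t i) (at t)" if i: "i \<in> I" and t: "t > 0" for i t
  proof -
    have "gradient_SO3 (\<lambda>X. K X (R k t)) (R i t) =
        - (a t i k *\<^sub>R (R k t - R i t ** transpose (R k t) ** R i t))" if k: "k \<in> I" for k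
      using gradient_SO3_radial[OF K_form g_deriv, of "R i t" "R k t"] mem[of i t] mem[of k t] near[of i k t] i k t
      by (simp add: a_def)
    then have "(\<Sum>k\<in>I. gradient_SO3 (\<lambda>X. K X (R k t)) (R i t)) = - W t i"
      by (simp add: W_def sum_negf)
    with sol_ode[OF i t] show ?thesis by simp
  qed
  \<comment> \<open>A monotone function of the distance that is differentiable also where two agents meet; it is
    at most 4, as inner products of rotations are at least \<open>-1\<close>.\<close>
  define f where "f = (\<lambda>(i, j) t. 3 - R i t \<bullet> R j t)"
  define f' where "f' = (\<lambda>(i, j) t. - (1 / real N) * (W t i \<bullet> R j t + R i t \<bullet> W t j))"
  have decay: "f (i, j) t \<le> 4 * exp (- (4 * c / real N) * t)" if ij: "i \<in> I" "j \<in> I" and t: "0 \<le> t" for i j t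
  proof (rule max_exp_decay[where S = "I \<times> I" and f' = f'])
    show "finite (I \<times> I)" by (simp add: I_def)
    show "(i, j) \<in> I \<times> I" "0 \<le> t" using that by auto
  next
    fix p assume "p \<in> I \<times> I"
    then show "continuous_on {0..} (f p)"
      unfolding f_def by (auto intro!: continuous_intros sol_cont)
  next
    fix p assume "p \<in> I \<times> I"
    then obtain i j where p: "p = (i, j)" "i \<in> I" "j \<in> I" by auto
    show "f p 0 \<le> 4"
      using SO3_inner_bounds(1)[of "R i 0" "R j 0"] mem[OF p(2), of 0] mem[OF p(3), of 0]
      by (simp add: f_def p(1))
  next
    fix p and t :: real assume "p \<in> I \<times> I" and t: "0 < t"
    then obtain i j where p: "p = (i, j)" "i \<in> I" "j \<in> I" by auto
    have "((\<lambda>t. 3 - R i t \<bullet> R j t) has_derivative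
        (\<lambda>h. 0 - (R i t \<bullet> (h *\<^sub>R ((1 / real N) *\<^sub>R W t j)) + (h *\<^sub>R ((1 / real N) *\<^sub>R W t i)) \<bullet> R j t))) (at t)"
      using ode[OF p(2) t] ode[OF p(3) t] unfolding has_vector_derivative_def
      by (intro derivative_intros)
    then show "(f p has_real_derivative f' p t) (at t)"
      unfolding p(1) f_def f'_def prod.case has_field_derivative_def
      by (rule has_derivative_eq_rhs) (auto simp: fun_eq_iff algebra_simps)
  next
    fix p and t :: real
    assume p: "p \<in> I \<times> I" and t: "0 < t" and "\<And>q. q \<in> I \<times> I \<Longrightarrow> f q t \<le> f p t"
    then obtain i j where ij: "p = (i, j)" "i \<in> I" "j \<in> I"
      and far: "\<And>k l. k \<in> I \<Longrightarrow> l \<in> I \<Longrightarrow> R i t \<bullet> R j t \<le> R k t \<bullet> R l t"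
      by (force simp: f_def)
    have t0: "0 \<le> t" using t by simp
    have fin: "finite I" by (simp add: I_def)
    have "2 * c * (3 - R i t \<bullet> R j t) \<le> W t i \<bullet> R j t"
      unfolding W_def
      using attraction_lower_bound[OF fin ij(2,3), of "\<lambda>k. R k t" c "a t i"] mem t0 near far weight ij c(1)
      by auto
    \<comment> \<open>The pair is also maximal with the roles of \<open>i\<close> and \<open>j\<close> exchanged.\<close>
    moreover have "2 * c * (3 - R j t \<bullet> R i t) \<le> W t j \<bullet> R i t"
      unfolding W_def
      using attraction_lower_bound[OF fin ij(3,2), of "\<lambda>k. R k t" c "a t j"] mem t0 near far weight ij c(1)
      by (auto simp: inner_commute[of "R j t" "R i t"])
    ultimately have "4 * c * f p t \<le> W t i \<bullet> R j t + R i t \<bullet> W t j"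
      by (simp add: ij f_def inner_commute)
    then have "(1 / real N) * (4 * c * f p t) \<le> (1 / real N) * (W t i \<bullet> R j t + R i t \<bullet> W t j)"
      by (intro mult_left_mono) simp_all
    then show "f' p t \<le> - (4 * c / real N) * f p t"
      by (simp add: f'_def ij(1))
  qed
  define \<mu> where "\<mu> = 2 * c / real N"
  have \<mu>: "\<mu> > 0" using c(1) N by (simp add: \<mu>_def)
  have bound: "dist_SO3 (R i t) (R j t) \<le> 3 * exp (- \<mu> * t)" if ij: "i \<in> I" "j \<in> I" and t: "t \<ge> 0" for i j t
  proof -
    let ?d = "dist_SO3 (R i t) (R j t)"
    have "?d\<^sup>2 \<le> 4 * (1 - cos ?d)"
      using dist_nonneg[OF ij t] dist_le[OF ij t] r by (intro square_le_one_sub_cos) auto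
    also have "\<dots> = 2 * f (i, j) t" unfolding cos_dist[OF ij t] by (simp add: f_def field_simps)
    \<comment> \<open>The factor 8 is enlarged to 9 to have a square.\<close>
    also have "\<dots> \<le> 9 * exp (- (4 * c / real N) * t)"
      using decay[OF ij t] exp_gt_zero[of "- (4 * c / real N) * t"] by linarith
    also have "\<dots> = (3 * exp (- \<mu> * t))\<^sup>2"
      by (simp add: power_mult_distrib \<mu>_def flip: exp_double)
    finally show ?thesis by (rule power2_le_imp_le) simp
  qed
  have lim: "((\<lambda>t. 3 * exp (- \<mu> * t)) \<longlongrightarrow> 0) at_top"
  proof -
    have "filterlim (\<lambda>t. - \<mu> * t) at_bot at_top"
      using \<mu> by (simp add: filterlim_uminus_at_bot filterlim_tendsto_pos_mult_at_top[OF tendsto_const _ filterlim_ident])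
    then have "((\<lambda>t. exp (- \<mu> * t)) \<longlongrightarrow> 0) at_top"
      by (rule filterlim_compose[OF exp_at_bot])
    then show ?thesis by (rule tendsto_mult_right_zero)
  qed
  show ?thesis
  proof (intro ballI conjI)
    fix i j assume ij: "i \<in> {1..N}" "j \<in> {1..N}"
    show "((\<lambda>t. dist_SO3 (R i t) (R j t)) \<longlongrightarrow> 0) at_top"
    proof (rule tendsto_sandwich[OF _ _ tendsto_const lim])
      show "\<forall>\<^sub>F t in at_top. 0 \<le> dist_SO3 (R i t) (R j t)"
        using eventually_ge_at_top[of "0::real"]
        by (rule eventually_mono) (use ij dist_nonneg in \<open>simp add: I_def\<close>)
      show "\<forall>\<^sub>F t in at_top. dist_SO3 (R i t) (R j t) \<le> 3 * exp (- \<mu> * t)"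
        using eventually_ge_at_top[of "0::real"]
        by (rule eventually_mono) (use ij bound in \<open>simp add: I_def\<close>)
    qed
    show "\<exists>A>0. \<exists>\<mu>>0. \<forall>t\<ge>0. dist_SO3 (R i t) (R j t) \<le> A * exp (- \<mu> * t)"
      using ij \<mu> bound by (intro exI[of _ 3] conjI exI[of _ \<mu>]) (auto simp: I_def)
  qed
qed

end
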